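(* Let $\mathcal D$ be a family of probability distributions over $\mathcal X^n$, $\mathcal Q$ a family of queries, and $\bar M=(M_1,\dots,M_k)$ a sequence of $k$ mechanisms $M_i:\mathcal X^n\times\mathcal Q\to\mathcal R$. Let $\mathcal D_{M_0,\mathcal Q}:=\mathcal D$ and, for $i>0$, let $\mathcal D_{M_i,\mathcal Q}$ be the set of all posterior distributions on $\mathcal X^n$ induced by any response of $M_i$ with non-zero probability with respect to $\mathcal D_{M_{i-1},\mathcal Q}$ and $\mathcal Q$. Let $0\le\epsilon_1,\delta_1,\dots,\epsilon_k,\delta_k\le1$. If for every $i\in\{1,\dots,k\}$, $M_i$ is $(\epsilon_i,\delta_i)$-LSS with respect to $\mathcal D_{M_{i-1},\mathcal Q}$ and $\mathcal Q$ (i.e. with respect to every distribution in $\mathcal D_{M_{i-1},\mathcal Q}$ and every query in $\mathcal Q$), then the sequence $\bar M$ is $\left(\sum_{i=1}^k\epsilon_i,\ \sum_{i=1}^k\delta_i\right)$-$k$-LSS with respect to $\mathcal D$ and any analyst $A$ that issues queries in $\mathcal Q$ and receives responses in $\mathcal R$.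
   Context: $\mathcal X$, $\mathcal Q$, $\mathcal R$ are countable sets and $n\in\mathbb N$. A mechanism $M:\mathcal X^n\times\mathcal Q\to\mathcal R$ is a possibly randomized function; for a distribution $D_{\mathcal X^n}$ on $\mathcal X^n$ and a fixed $q$, write $D(r\mid s)=\Pr[M(s,q)=r]$, $D(s)=D_{\mathcal X^n}(s)$, $D(r)=\sum_sD(s)D(r\mid s)$, $D(s\mid r)=D(s)D(r\mid s)/D(r)$. For $s=(s_1,\dots,s_n)$, $D(x\mid s)=\frac1n|\{i:s_i=x\}|$; $D(x)=\sum_sD(s)D(x\mid s)$; $D(x\mid r)=\sum_sD(s\mid r)D(x\mid s)$. Only $r$ with $D(r)>0$ matter. Stability loss: $\ell(r)=\sum_{x:\,D(x\mid r)>D(x)}(D(x\mid r)-D(x))$. $M$ is $(\epsilon,\delta)$-LSS (Local-Statistically Stable) with respect to $D_{\mathcal X^n}$ and $q$ if for every $\mathbf r\subseteq\mathcal R$, $\sum_{r\in\mathbf r}D(r)(\ell(r)-\epsilon)\le\delta$; with respect to families of distributions and queries if this holds for every member of the families. (The inequality makes sense, and holds trivially, when $\epsilon\geq 1$ or $\delta\ge1$.) Posterior family: $\mathcal D_{M_i,\mathcal Q}$ consists of all distributions $s\mapsto P(s)\Pr[M_i(s,q)=r]/\sum_{s'}P(s')\Pr[M_i(s',q)=r]$ with $P\in\mathcal D_{M_{i-1},\mathcal Q}$, $q\in\mathcal Q$, $r\in\mathcal R$ and positive denominator. Adaptivity: an analyst is a possibly randomized function $A:\mathcal R^*\to\mathcal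 Q$ mapping a finite sequence of responses to a query. The adaptive mechanism $\mathrm{Adp}_{\bar M}$, on input $s\in\mathcal X^n$ and $A$, does the following: $v_0\leftarrow\emptyset$ (if $A$ is randomized, $v_0\leftarrow c$ where $c$ are $A$'s coin tosses, drawn independently of $s$ from a discrete distribution; then $A$ is a deterministic function of the view); for $i=1,\dots,k$: $q_i\leftarrow A(v_{i-1})$, $r_i\leftarrow M_i(s,q_i)$ (fresh randomness), $v_i\leftarrow(v_{i-1},r_i)$. It outputs the view $v_k$. Viewing $A$ as the "query" and $v_k$ as the "response", $\mathrm{Adp}_{\bar M}$ is itself a mechanism; $\bar M$ is called $(\epsilon,\delta)$-$k$-LSS with respect to $D_{\mathcal X^n}$ and $A$ if $\mathrm{Adp}_{\bar M}$ is $(\epsilon,\delta)$-LSS with respect to $D_{\mathcal X^n}$ and $A$, and with respect to a family $\mathcal D$ if this holds for each $D_{\mathcal X^n}\in\mathcal D$. *)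

theory Defs
  imports "HOL-Probability.Probability"
begin

text \<open>
  A dataset in $X^n$ is a list of length $n$; a mechanism maps a dataset and a query to the
  distribution of its response. In the usual notation, for a data distribution $D(s)$ and a fixed
  query, the five probabilities below are $D(r)$, $D(s \mid r)$, $D(x \mid s)$, $D(x)$ and
  $D(x \mid r)$, in this order. The datasets in question all have length $n$, so $D(x \mid s)$ can
  divide by the length of $s$. All infinite sums are absolutely convergent: the terms are bounded
  by constant multiples of the masses of discrete distributions.
\<close>

type_synonym ('x, 'q, 'r) mechanism = "'x list \<Rightarrow> 'q \<Rightarrow> 'r pmf"

definition resp_prob :: "'x list pmf \<Rightarrow> ('x, 'q, 'r) mechanism \<Rightarrow> 'q \<Rightarrow> 'r \<Rightarrow> real" where
  "resp_prob P M q r = (\<Sum>\<^sub>\<infinity>s. pmf P s * pmf (M s q) r)"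

definition posterior_prob ::
    "'x list pmf \<Rightarrow> ('x, 'q, 'r) mechanism \<Rightarrow> 'q \<Rightarrow> 'r \<Rightarrow> 'x list \<Rightarrow> real" where
  "posterior_prob P M q r s = pmf P s * pmf (M s q) r / resp_prob P M q r"

definition sample_prob :: "'x list \<Rightarrow> 'x \<Rightarrow> real" where
  "sample_prob s x = real (card {i. i < length s \<and> s ! i = x}) / real (length s)"

definition elem_prob :: "'x list pmf \<Rightarrow> 'x \<Rightarrow> real" where
  "elem_prob P x = (\<Sum>\<^sub>\<infinity>s. pmf P s * sample_prob s x)"

definition elem_posterior_prob ::
    "'x list pmf \<Rightarrow> ('x, 'q, 'r) mechanism \<Rightarrow> 'q \<Rightarrow> 'r \<Rightarrow> 'x \<Rightarrow> real" where
  "elem_posterior_prob P M q r x =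
     (\<Sum>\<^sub>\<infinity>s. posterior_prob P M q r s * sample_prob s x)"

definition stability_loss ::
    "'x list pmf \<Rightarrow> ('x, 'q, 'r) mechanism \<Rightarrow> 'q \<Rightarrow> 'r \<Rightarrow> real" where
  "stability_loss P M q r =
     (\<Sum>\<^sub>\<infinity>x\<in>{x. elem_posterior_prob P M q r x > elem_prob P x}.
        elem_posterior_prob P M q r x - elem_prob P x)"

text \<open>Responses of probability 0 contribute nothing to the sum, whatever their loss.\<close>
definition LSS ::
    "real \<Rightarrow> real \<Rightarrow> ('x, 'q, 'r) mechanism \<Rightarrow> 'x list pmf \<Rightarrow> 'q \<Rightarrow> bool" where
  "LSS \<epsilon> \<delta> M P q \<longleftrightarrow>
     (\<forall>S :: 'r set.
        (\<Sum>\<^sub>\<infinity>r\<in>S. resp_prob P M q r * (stability_loss P M q r - \<epsilon>)) \<le> \<delta>)"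

definition LSS_family ::
    "real \<Rightarrow> real \<Rightarrow> ('x, 'q, 'r) mechanism \<Rightarrow> 'x list pmf set \<Rightarrow> 'q set \<Rightarrow> bool" where
  "LSS_family \<epsilon> \<delta> M \<D> \<Q> \<longleftrightarrow> (\<forall>P\<in>\<D>. \<forall>q\<in>\<Q>. LSS \<epsilon> \<delta> M P q)"

text \<open>The mechanisms of a sequence are indexed from 1.\<close>
primrec posterior_family ::
    "(nat \<Rightarrow> ('x, 'q, 'r) mechanism) \<Rightarrow> 'q set \<Rightarrow> 'x list pmf set \<Rightarrow> nat \<Rightarrow> 'x list pmf set" where
  "posterior_family M \<Q> \<D> 0 = \<D>"
| "posterior_family M \<Q> \<D> (Suc i) =
     {P'. \<exists>P\<in>posterior_family M \<Q> \<D> i. \<exists>q\<in>\<Q>. \<exists>r. resp_prob P (M (Suc i)) q r > 0 \<and>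
        (\<forall>s. pmf P' s = posterior_prob P (M (Suc i)) q r s)}"

text \<open>
  A randomized analyst draws its coins once, up front and independently of the dataset, and is a
  deterministic function of the coins and the responses so far. The coins are part of the view.
\<close>
datatype ('c, 'q, 'r) analyst =
    Deterministic "'r list \<Rightarrow> 'q"
  | Randomized "'c pmf" "'c \<Rightarrow> 'r list \<Rightarrow> 'q"

datatype ('c, 'r) view =
    View (coins: "'c option") (responses: "'r list")

primrec initial_view :: "('c, 'q, 'r) analyst \<Rightarrow> ('c, 'r) view pmf" where
  "initial_view (Deterministic f) = return_pmf (View None [])"
| "initial_view (Randomized C f) = map_pmf (\<lambda>c. View (Some c) []) C"

primrec next_query :: "('c, 'q, 'r) analyst \<Rightarrow> ('c, 'r) view \<Rightarrow> 'q" where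
  "next_query (Deterministic f) v = f (responses v)"
| "next_query (Randomized C f) v = f (the (coins v)) (responses v)"

primrec issues_queries_in :: "('c, 'q, 'r) analyst \<Rightarrow> 'q set \<Rightarrow> bool" where
  "issues_queries_in (Deterministic f) \<Q> \<longleftrightarrow> (\<forall>rs. f rs \<in> \<Q>)"
| "issues_queries_in (Randomized C f) \<Q> \<longleftrightarrow> (\<forall>c\<in>set_pmf C. \<forall>rs. f c rs \<in> \<Q>)"

definition extend_view :: "('c, 'r) view \<Rightarrow> 'r \<Rightarrow> ('c, 'r) view" where
  "extend_view v r = View (coins v) (responses v @ [r])"

primrec adaptive_mechanism ::
    "(nat \<Rightarrow> ('x, 'q, 'r) mechanism) \<Rightarrow> nat \<Rightarrow>
     ('x, ('c, 'q, 'r) analyst, ('c, 'r) view) mechanism" where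
  "adaptive_mechanism M 0 = (\<lambda>s A. initial_view A)"
| "adaptive_mechanism M (Suc i) = (\<lambda>s A. do {
     v \<leftarrow> adaptive_mechanism M i s A;
     r \<leftarrow> M (Suc i) s (next_query A v);
     return_pmf (extend_view v r)
   })"

definition k_LSS ::
    "real \<Rightarrow> real \<Rightarrow> nat \<Rightarrow> (nat \<Rightarrow> ('x, 'q, 'r) mechanism) \<Rightarrow> 'x list pmf set \<Rightarrow>
     ('c, 'q, 'r) analyst \<Rightarrow> bool" where
  "k_LSS \<epsilon> \<delta> k M \<D> A \<longleftrightarrow> (\<forall>P\<in>\<D>. LSS \<epsilon> \<delta> (adaptive_mechanism M k) P A)"

end

theory Submission
  imports Defs
begin

text \<open>
  A mechanism is LSS if and only if the positive part of \<open>\<ell>(r) - \<epsilon>\<close> has expectation at most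
  \<open>\<delta>\<close>: the worst set of responses is the set where \<open>\<ell>(r) \<ge> \<epsilon>\<close>. The loss of a response is a
  one-sided statistical distance between the posterior and the prior, which satisfies the triangle
  inequality, and the posterior after a view \<open>(v, r)\<close> arises by first conditioning on \<open>v\<close> and then
  updating the result on \<open>r\<close>. So the loss of \<open>(v, r)\<close> is at most the loss of \<open>v\<close> plus the loss of
  \<open>r\<close> with respect to the posterior after \<open>v\<close>, and since positive parts are subadditive, the
  bounds \<open>\<delta>\<^sub>i\<close> add up along the sequence.
\<close>

section \<open>Expectations as infinite sums\<close>

text \<open>Comparison with \<open>B\<close> times the masses gives absolute summability, which
  identifies the unordered sum with the integral.\<close>

lemma infsum_pmf_times:
  fixes f :: "'a \<Rightarrow> real"
  assumes bounded: "\<And>a. \<bar>f a\<bar> \<le> B"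
  shows "(\<Sum>\<^sub>\<infinity>a. pmf p a * f a) = measure_pmf.expectation p f"
proof -
  have "Infinite_Set_Sum.abs_summable_on (\<lambda>a. pmf p a * B) UNIV"
    by (intro abs_summable_on_cmult_left pmf_abs_summable)
  moreover have "norm (pmf p a * f a) \<le> norm (pmf p a * B)" for a
    using bounded[of a] by (auto simp: abs_mult intro!: mult_left_mono)
  ultimately have "Infinite_Set_Sum.abs_summable_on (\<lambda>a. pmf p a * f a) UNIV"
    by (rule abs_summable_on_comparison_test)
  then show ?thesis
    by (simp add: pmf_expectation_eq_infsetsum infsetsum_infsum)
qed

lemma infsum_on_pmf_times:
  fixes f :: "'a \<Rightarrow> real"
  assumes "\<And>a. \<bar>f a\<bar> \<le> B"
  shows "(\<Sum>\<^sub>\<infinity>a\<in>S. pmf p a * f a) = measure_pmf.expectation p (\<lambda>a. indicator S a * f a)"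
proof -
  have "0 \<le> B"
    using assms[of undefined] by simp
  have "(\<Sum>\<^sub>\<infinity>a\<in>S. pmf p a * f a) = (\<Sum>\<^sub>\<infinity>a. pmf p a * (indicator S a * f a))"
    by (rule infsum_cong_neutral) auto
  also have "\<dots> = measure_pmf.expectation p (\<lambda>a. indicator S a * f a)"
    by (rule infsum_pmf_times[of _ B]) (use assms \<open>0 \<le> B\<close> in \<open>auto simp: indicator_def\<close>)
  finally show ?thesis .
qed

section \<open>Joint distributions and posteriors\<close>

text \<open>Recording \<open>a\<close> in the outcome leaves at most one nonzero term in the mixture
  over \<open>p\<close>. Joint laws are compared through this product formula.\<close>

lemma pmf_bind_Pair:
  "pmf (bind_pmf p (\<lambda>a. map_pmf (Pair a) (K a))) (a, b) = pmf p a * pmf (K a) b"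
proof -
  have "pmf (map_pmf (Pair c) (K c)) (a, b) = indicator {a} c * pmf (K a) b" for c
  proof (cases "c = a")
    case True
    then show ?thesis
      by (simp add: pmf_map_inj' inj_on_def)
  next
    case False
    then show ?thesis
      by (auto simp: pmf_eq_0_set_pmf)
  qed
  then show ?thesis
    by (simp add: pmf_bind measure_pmf_single)
qed

definition response :: "'x list pmf \<Rightarrow> ('x, 'q, 'r) mechanism \<Rightarrow> 'q \<Rightarrow> 'r pmf" where
  "response P M q = bind_pmf P (\<lambda>s. M s q)"

text \<open>Unspecified when the response has probability 0.\<close>
definition posterior :: "'x list pmf \<Rightarrow> ('x, 'q, 'r) mechanism \<Rightarrow> 'q \<Rightarrow> 'r \<Rightarrow> 'x list pmf" where
  "posterior P M q r = embed_pmf (posterior_prob P M q r)"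

lemma resp_prob_eq: "resp_prob P M q r = pmf (response P M q) r"
  unfolding resp_prob_def response_def pmf_bind
  by (rule infsum_pmf_times[of _ 1]) (simp add: pmf_le_1)

text \<open>\<open>embed_pmf\<close> needs nonnegative weights of total mass 1. The numerators sum
  to the mass of \<open>r\<close> under \<open>response\<close>, which is positive on the support,
  so dividing by it normalizes.\<close>

lemma pmf_posterior:
  assumes "r \<in> set_pmf (response P M q)"
  shows "pmf (posterior P M q r) s = posterior_prob P M q r s"
proof -
  let ?d = "pmf (response P M q) r"
  have d: "?d > 0"
    using assms by (simp add: pmf_positive)
  have "(\<integral>\<^sup>+s. ennreal (posterior_prob P M q r s) \<partial>count_space UNIV)
      = (\<integral>\<^sup>+s. ennreal (pmf P s) * ennreal (pmf (M s q) r) / ennreal ?d \<partial>count_space UNIV)"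
    by (intro nn_integral_cong)
      (simp add: posterior_prob_def resp_prob_eq d ennreal_mult flip: divide_ennreal)
  also have "\<dots> = (\<integral>\<^sup>+s. ennreal (pmf P s) * ennreal (pmf (M s q) r) \<partial>count_space UNIV) / ennreal ?d"
    by (rule nn_integral_divide) simp
  also have "\<dots> = 1"
    using d by (simp add: response_def ennreal_pmf_bind flip: nn_integral_measure_pmf)
      (simp add: ennreal_divide_self flip: ennreal_pmf_bind)
  finally show ?thesis
    unfolding posterior_def
    by (intro pmf_embed_pmf) (simp_all add: posterior_prob_def resp_prob_eq)
qed

text \<open>Bayes' rule without division. Off the support both sides vanish whatever
  \<open>posterior\<close> is there, so rewriting with it carries no side condition.\<close>

lemma pmf_response_times_posterior:
  "pmf (response P M q) r * pmf (posterior P M q r) s = pmf P s * pmf (M s q) r"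
proof (cases "r \<in> set_pmf (response P M q)")
  case True
  then show ?thesis
    by (simp add: pmf_posterior posterior_prob_def resp_prob_eq set_pmf_iff)
next
  case False
  then have "pmf (response P M q) r = 0" and "pmf P s = 0 \<or> pmf (M s q) r = 0"
    by (auto simp: response_def pmf_eq_0_set_pmf)
  then show ?thesis
    by auto
qed

text \<open>By Bayes' rule the two orders of sampling give the same joint law of dataset and
  response; \<open>K\<close> is then applied to it. This allows conditioning on a view before the
  next mechanism runs.\<close>

lemma bind_response_posterior:
  "bind_pmf P (\<lambda>s. bind_pmf (M s q) (\<lambda>r. K s r))
    = bind_pmf (response P M q) (\<lambda>r. bind_pmf (posterior P M q r) (\<lambda>s. K s r))"
proof -
  let ?J = "bind_pmf P (\<lambda>s. map_pmf (Pair s) (M s q))"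
  let ?J' = "bind_pmf (response P M q) (\<lambda>r. map_pmf (Pair r) (posterior P M q r))"
  have "pmf ?J z = pmf (map_pmf prod.swap ?J') z" for z
  proof -
    have "pmf (map_pmf prod.swap ?J') (prod.swap (snd z, fst z)) = pmf ?J' (snd z, fst z)"
      by (rule pmf_map_inj') simp
    then show ?thesis
      by (cases z) (simp add: pmf_bind_Pair pmf_response_times_posterior)
  qed
  then have "?J = map_pmf prod.swap ?J'"
    by (rule pmf_eqI)
  then have "bind_pmf ?J (\<lambda>(s, r). K s r) = bind_pmf (map_pmf prod.swap ?J') (\<lambda>(s, r). K s r)"
    by simp
  then show ?thesis
    by (simp add: bind_assoc_pmf bind_map_pmf)
qed

section \<open>Stability loss as a statistical distance\<close>

lemma sample_prob_nonneg: "0 \<le> sample_prob s x"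
  by (simp add: sample_prob_def)

text \<open>The position sets of distinct elements are disjoint. For the empty list every term is 0,
  since division by 0 yields 0.\<close>

lemma sum_sample_prob_le_1:
  assumes "finite F"
  shows "(\<Sum>x\<in>F. sample_prob s x) \<le> 1"
proof -
  have "(\<Sum>x\<in>F. card {i. i < length s \<and> s ! i = x}) = card (\<Union>x\<in>F. {i. i < length s \<and> s ! i = x})"
    by (rule card_UN_disjoint[symmetric]) (use assms in auto)
  also have "\<dots> \<le> card {..<length s}"
    by (rule card_mono) auto
  finally have "(\<Sum>x\<in>F. real (card {i. i < length s \<and> s ! i = x})) \<le> real (length s)"
    by (simp flip: of_nat_sum)
  then show ?thesis
    by (auto simp: sample_prob_def divide_le_eq_1 simp flip: sum_divide_distrib)
qed

lemma sample_prob_le_1: "sample_prob s x \<le> 1"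
  using sum_sample_prob_le_1[of "{x}" s] by simp

lemma elem_prob_eq: "elem_prob P x = measure_pmf.expectation P (\<lambda>s. sample_prob s x)"
  unfolding elem_prob_def
  by (rule infsum_pmf_times[of _ 1]) (simp add: sample_prob_nonneg sample_prob_le_1)

lemma elem_prob_nonneg: "0 \<le> elem_prob P x"
  by (simp add: elem_prob_eq sample_prob_nonneg)

lemma sum_elem_prob_le_1:
  assumes "finite F"
  shows "(\<Sum>x\<in>F. elem_prob P x) \<le> 1"
proof -
  have int: "integrable (measure_pmf P) (\<lambda>s. sample_prob s x)" for x
    by (rule measure_pmf.integrable_const_bound[where B = 1])
      (auto simp: sample_prob_nonneg sample_prob_le_1)
  have "(\<Sum>x\<in>F. elem_prob P x) = measure_pmf.expectation P (\<lambda>s. \<Sum>x\<in>F. sample_prob s x)"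
    by (simp add: elem_prob_eq int)
  also have "\<dots> \<le> 1"
    by (rule measure_pmf.integral_le_const) (auto simp: int sum_sample_prob_le_1 assms)
  finally show ?thesis .
qed

text \<open>Positive parts over all elements avoid a summation set that depends on the pair, so
  estimates can be made termwise. If both element distributions have mass 1, this is their total
  variation distance.\<close>

definition stat_dist :: "'x list pmf \<Rightarrow> 'x list pmf \<Rightarrow> real" where
  "stat_dist P' P = (\<Sum>\<^sub>\<infinity>x. max 0 (elem_prob P' x - elem_prob P x))"

lemma
  shows summable_elem_prob: "elem_prob P summable_on UNIV"
    and infsum_elem_prob_le_1: "(\<Sum>\<^sub>\<infinity>x. elem_prob P x) \<le> 1"
proof -
  show *: "elem_prob P summable_on UNIV"
    by (rule nonneg_bdd_above_summable_on)
      (auto simp: elem_prob_nonneg sum_elem_prob_le_1 intro!: bdd_aboveI2[of _ _ 1])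
  show "(\<Sum>\<^sub>\<infinity>x. elem_prob P x) \<le> 1"
    by (rule infsum_le_finite_sums[OF *]) (simp add: sum_elem_prob_le_1)
qed

lemma summable_stat_dist: "(\<lambda>x. max 0 (elem_prob P' x - elem_prob P x)) summable_on UNIV"
  by (rule summable_on_comparison_test[OF summable_elem_prob[of P']])
    (auto simp: elem_prob_nonneg)

lemma stat_dist_nonneg: "0 \<le> stat_dist P' P"
  unfolding stat_dist_def by (rule infsum_nonneg) simp

lemma stat_dist_le_1: "stat_dist P' P \<le> 1"
proof -
  have "stat_dist P' P \<le> (\<Sum>\<^sub>\<infinity>x. elem_prob P' x)"
    unfolding stat_dist_def
    by (rule infsum_mono[OF summable_stat_dist summable_elem_prob]) (simp add: elem_prob_nonneg)
  then show ?thesis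
    using infsum_elem_prob_le_1[of P'] by linarith
qed

lemma stat_dist_self [simp]: "stat_dist P P = 0"
  by (simp add: stat_dist_def)

text \<open>Termwise, the positive part of a sum is at most the sum of the positive parts;
  summability then splits the series.\<close>

lemma stat_dist_triangle: "stat_dist P'' P \<le> stat_dist P'' P' + stat_dist P' P"
proof -
  have "stat_dist P'' P \<le> (\<Sum>\<^sub>\<infinity>x. max 0 (elem_prob P'' x - elem_prob P' x)
      + max 0 (elem_prob P' x - elem_prob P x))"
    unfolding stat_dist_def
    by (rule infsum_mono) (auto intro!: summable_on_add summable_stat_dist)
  also have "\<dots> = stat_dist P'' P' + stat_dist P' P"
    unfolding stat_dist_def by (rule infsum_add[OF summable_stat_dist summable_stat_dist])
  finally show ?thesis .
qed

section \<open>Stability as a bound on the expected excess distance\<close>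

lemma stability_loss_eq:
  assumes "r \<in> set_pmf (response P M q)"
  shows "stability_loss P M q r = stat_dist (posterior P M q r) P"
proof -
  have "elem_posterior_prob P M q r = elem_prob (posterior P M q r)"
    by (simp add: fun_eq_iff elem_posterior_prob_def elem_prob_def pmf_posterior[OF assms])
  then show ?thesis
    unfolding stability_loss_def stat_dist_def by (intro infsum_cong_neutral) auto
qed

lemma LSS_iff_expectation:
  "LSS \<epsilon> \<delta> M P q \<longleftrightarrow>
    (\<forall>S. measure_pmf.expectation (response P M q)
      (\<lambda>r. indicator S r * (stat_dist (posterior P M q r) P - \<epsilon>)) \<le> \<delta>)"
proof -
  have "(\<Sum>\<^sub>\<infinity>r\<in>S. resp_prob P M q r * (stability_loss P M q r - \<epsilon>))
      = measure_pmf.expectation (response P M q)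
          (\<lambda>r. indicator S r * (stat_dist (posterior P M q r) P - \<epsilon>))" for S
  proof -
    have "(\<Sum>\<^sub>\<infinity>r\<in>S. resp_prob P M q r * (stability_loss P M q r - \<epsilon>))
        = (\<Sum>\<^sub>\<infinity>r\<in>S. pmf (response P M q) r * (stat_dist (posterior P M q r) P - \<epsilon>))"
    proof (rule infsum_cong)
      fix r
      \<comment> \<open>Off the support both sides are 0, so the unspecified posterior there is
        harmless.\<close>
      show "resp_prob P M q r * (stability_loss P M q r - \<epsilon>)
          = pmf (response P M q) r * (stat_dist (posterior P M q r) P - \<epsilon>)"
        by (cases "r \<in> set_pmf (response P M q)")
          (simp_all add: resp_prob_eq stability_loss_eq pmf_eq_0_set_pmf)
    qed
    also have "\<dots> = measure_pmf.expectation (response P M q)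
        (\<lambda>r. indicator S r * (stat_dist (posterior P M q r) P - \<epsilon>))"
    proof (rule infsum_on_pmf_times[where B = "1 + \<bar>\<epsilon>\<bar>"])
      show "\<bar>stat_dist (posterior P M q r) P - \<epsilon>\<bar> \<le> 1 + \<bar>\<epsilon>\<bar>" for r
        using stat_dist_nonneg[of "posterior P M q r" P] stat_dist_le_1[of "posterior P M q r" P]
        by linarith
    qed
    finally show ?thesis .
  qed
  then show ?thesis
    by (simp add: LSS_def)
qed

text \<open>\<open>ennreal\<close> truncates negative reals to 0, so the integrand is the positive part.\<close>
lemma LSS_iff_nn_integral:
  "LSS \<epsilon> \<delta> M P q \<longleftrightarrow> 0 \<le> \<delta> \<and>
    (\<integral>\<^sup>+r. ennreal (stat_dist (posterior P M q r) P - \<epsilon>) \<partial>response P M q) \<le> ennreal \<delta>"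
proof -
  let ?R = "measure_pmf (response P M q)"
  let ?f = "\<lambda>r. stat_dist (posterior P M q r) P - \<epsilon>"
  have bound: "\<bar>?f r\<bar> \<le> 1 + \<bar>\<epsilon>\<bar>" for r
    using stat_dist_nonneg[of "posterior P M q r" P] stat_dist_le_1[of "posterior P M q r" P]
    by linarith
  have "\<bar>max 0 (?f r)\<bar> \<le> 1 + \<bar>\<epsilon>\<bar>" for r
    using bound[of r] by linarith
  then have int: "integrable ?R (\<lambda>r. max 0 (?f r))"
    by (intro measure_pmf.integrable_const_bound[where B = "1 + \<bar>\<epsilon>\<bar>"]) auto
  have intS: "integrable ?R (\<lambda>r. indicator S r * ?f r)" for S
    by (rule measure_pmf.integrable_const_bound[where B = "1 + \<bar>\<epsilon>\<bar>"])
      (use bound in \<open>auto simp: indicator_def\<close>)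
  have nn: "(\<integral>\<^sup>+r. ennreal (?f r) \<partial>?R) = ennreal (\<integral>r. max 0 (?f r) \<partial>?R)"
    using nn_integral_eq_integral[OF int] by simp
  show ?thesis
    unfolding LSS_iff_expectation nn
  proof (intro iffI conjI allI)
    assume *: "\<forall>S. (\<integral>r. indicator S r * ?f r \<partial>?R) \<le> \<delta>"
    \<comment> \<open>The empty set yields this. It is a separate conjunct because
      \<open>ennreal\<close> sends a negative \<delta> to 0.\<close>
    show "0 \<le> \<delta>"
      using *[rule_format, of "{}"] by simp
    have "(\<integral>r. max 0 (?f r) \<partial>?R) = (\<integral>r. indicator {r. 0 \<le> ?f r} r * ?f r \<partial>?R)"
      by (rule Bochner_Integration.integral_cong) (auto simp: indicator_def)
    also have "\<dots> \<le> \<delta>"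
      by (rule *[rule_format])
    finally show "ennreal (\<integral>r. max 0 (?f r) \<partial>?R) \<le> ennreal \<delta>"
      by (rule ennreal_leI)
  next
    fix S
    assume *: "0 \<le> \<delta> \<and> ennreal (\<integral>r. max 0 (?f r) \<partial>?R) \<le> ennreal \<delta>"
    have "(\<integral>r. indicator S r * ?f r \<partial>?R) \<le> (\<integral>r. max 0 (?f r) \<partial>?R)"
      by (rule integral_mono[OF intS int]) (auto simp: indicator_def)
    also have "\<dots> \<le> \<delta>"
      by (rule iffD1[OF ennreal_le_iff]) (use * in blast)+
    finally show "(\<integral>r. indicator S r * ?f r \<partial>?R) \<le> \<delta>" .
  qed
qed

section \<open>Adaptive composition\<close>

lemma extend_view_eq_iff [simp]: "extend_view v r = extend_view v' r' \<longleftrightarrow> v = v' \<and> r = r'"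
  by (cases v; cases v') (auto simp: extend_view_def)

lemma coins_extend_view [simp]: "coins (extend_view v r) = coins v"
  by (simp add: extend_view_def)

lemma pmf_adaptive_mechanism_extend_view:
  "pmf (adaptive_mechanism M (Suc i) s A) (extend_view v r)
    = pmf (adaptive_mechanism M i s A) v * pmf (M (Suc i) s (next_query A v)) r"
proof -
  let ?J = "bind_pmf (adaptive_mechanism M i s A)
      (\<lambda>v. map_pmf (Pair v) (M (Suc i) s (next_query A v)))"
  have "adaptive_mechanism M (Suc i) s A = map_pmf (\<lambda>(v, r). extend_view v r) ?J"
    by (simp add: map_bind_pmf pmf.map_comp o_def) (simp add: map_pmf_def)
  moreover have "pmf (map_pmf (\<lambda>(v, r). extend_view v r) ?J) ((\<lambda>(v, r). extend_view v r) (v, r))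
      = pmf ?J (v, r)"
    by (rule pmf_map_inj') (auto simp: inj_def)
  ultimately show ?thesis
    by (simp add: pmf_bind_Pair)
qed

text \<open>Given \<open>v\<close>, the next query no longer depends on the dataset. So once the
  order of sampling is swapped, the next mechanism simply runs on the posterior given
  \<open>v\<close>.\<close>

lemma response_adaptive_mechanism_Suc:
  "response P (adaptive_mechanism M (Suc i)) A
    = bind_pmf (response P (adaptive_mechanism M i) A)
        (\<lambda>v. map_pmf (extend_view v)
          (response (posterior P (adaptive_mechanism M i) A v) (M (Suc i)) (next_query A v)))"
proof -
  have "response P (adaptive_mechanism M (Suc i)) A
      = bind_pmf P (\<lambda>s. bind_pmf (adaptive_mechanism M i s A)
          (\<lambda>v. map_pmf (extend_view v) (M (Suc i) s (next_query A v))))"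
    by (simp add: response_def map_pmf_def)
  also have "\<dots> = bind_pmf (response P (adaptive_mechanism M i) A)
      (\<lambda>v. bind_pmf (posterior P (adaptive_mechanism M i) A v)
        (\<lambda>s. map_pmf (extend_view v) (M (Suc i) s (next_query A v))))"
    by (rule bind_response_posterior)
  finally show ?thesis
    by (simp add: response_def map_bind_pmf)
qed

section \<open>Posteriors along the interaction\<close>

lemma posterior_initial_view:
  assumes "v \<in> set_pmf (response P (adaptive_mechanism M 0) A)"
  shows "posterior P (adaptive_mechanism M 0) A v = P"
proof (rule pmf_eqI)
  fix s
  \<comment> \<open>The initial view holds at most coins, drawn independently of the dataset, so its
    likelihood is the same for every \<open>s\<close> and cancels.\<close>
  have "response P (adaptive_mechanism M 0) A = initial_view A"
    by (simp add: response_def)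
  then show "pmf (posterior P (adaptive_mechanism M 0) A v) s = pmf P s"
    using assms by (simp add: pmf_posterior posterior_prob_def resp_prob_eq set_pmf_iff)
qed

text \<open>Sequential Bayesian updating: multiplied by the joint mass of \<open>v\<close> and
  \<open>r\<close>, each side becomes the prior mass of \<open>s\<close> times the likelihoods of
  \<open>v\<close> and \<open>r\<close>. That positive factor cancels.\<close>

lemma posterior_extend_view:
  fixes P M i A v
  defines "Q \<equiv> posterior P (adaptive_mechanism M i) A v"
  assumes v: "v \<in> set_pmf (response P (adaptive_mechanism M i) A)"
    and r: "r \<in> set_pmf (response Q (M (Suc i)) (next_query A v))"
  shows "posterior P (adaptive_mechanism M (Suc i)) A (extend_view v r)
    = posterior Q (M (Suc i)) (next_query A v) r"
proof (rule pmf_eqI)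
  fix s
  let ?D = "response P (adaptive_mechanism M i) A"
  let ?D' = "response P (adaptive_mechanism M (Suc i)) A"
  let ?E = "response Q (M (Suc i)) (next_query A v)"
  let ?w = "extend_view v r"
  have "?D' = map_pmf (\<lambda>(v, r). extend_view v r) (bind_pmf ?D (\<lambda>v. map_pmf (Pair v)
      (response (posterior P (adaptive_mechanism M i) A v) (M (Suc i)) (next_query A v))))"
    by (simp add: response_adaptive_mechanism_Suc map_bind_pmf pmf.map_comp o_def
        del: adaptive_mechanism.simps)
  moreover have "pmf (map_pmf (\<lambda>(v, r). extend_view v r) J) ((\<lambda>(v, r). extend_view v r) (v, r))
      = pmf J (v, r)" for J
    by (rule pmf_map_inj') (auto simp: inj_def)
  ultimately have D': "pmf ?D' ?w = pmf ?D v * pmf ?E r"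
    by (simp add: pmf_bind_Pair Q_def del: adaptive_mechanism.simps)
  have pos: "pmf ?D v > 0" "pmf ?E r > 0"
    using v r by (simp_all add: pmf_positive)
  have "pmf ?D v * pmf ?E r * pmf (posterior P (adaptive_mechanism M (Suc i)) A ?w) s
      = pmf P s * pmf (adaptive_mechanism M i s A) v * pmf (M (Suc i) s (next_query A v)) r"
    using pmf_response_times_posterior[of P "adaptive_mechanism M (Suc i)" A ?w s]
    by (simp add: D' pmf_adaptive_mechanism_extend_view mult.assoc del: adaptive_mechanism.simps)
  also have "\<dots> = pmf ?D v * (pmf Q s * pmf (M (Suc i) s (next_query A v)) r)"
    by (simp add: Q_def mult.assoc flip: pmf_response_times_posterior)
  also have "\<dots> = pmf ?D v * pmf ?E r * pmf (posterior Q (M (Suc i)) (next_query A v) r) s"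
    by (simp add: mult.assoc flip: pmf_response_times_posterior)
  finally show "pmf (posterior P (adaptive_mechanism M (Suc i)) A ?w) s
      = pmf (posterior Q (M (Suc i)) (next_query A v) r) s"
    using pos by simp
qed

text \<open>A randomized analyst is constrained only for coins in the support of \<open>C\<close>.
  Extending a view keeps its coins, so every reachable view carries coins of some initial
  view.\<close>

lemma next_query_in:
  assumes "issues_queries_in A \<Q>" and "v \<in> set_pmf (response P (adaptive_mechanism M i) A)"
  shows "next_query A v \<in> \<Q>"
proof -
  have "coins v \<in> coins ` set_pmf (initial_view A)"
    if "v \<in> set_pmf (adaptive_mechanism M i s A)" for s
    using that by (induction i arbitrary: v) fastforce+
  then have "coins v \<in> coins ` set_pmf (initial_view A)"
    using assms(2) by (auto simp: response_def)
  then show ?thesis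
    using assms(1) by (cases A) auto
qed

text \<open>Peeling off the last response exhibits the posterior as a one-step update of an earlier
  one, by a query in \<open>\<Q>\<close> and a response of positive probability. This makes the
  stability hypothesis on \<open>M (Suc i)\<close> applicable after \<open>i\<close>
  responses.\<close>

lemma posterior_in_posterior_family:
  assumes "issues_queries_in A \<Q>" "P \<in> \<D>"
    and "v \<in> set_pmf (response P (adaptive_mechanism M i) A)"
  shows "posterior P (adaptive_mechanism M i) A v \<in> posterior_family M \<Q> \<D> i"
  using assms(3)
proof (induction i arbitrary: v)
  case 0
  then show ?case
    by (simp only: posterior_initial_view posterior_family.simps assms)
next
  case (Suc i)
  from Suc.prems obtain u r where v: "v = extend_view u r"
    and u: "u \<in> set_pmf (response P (adaptive_mechanism M i) A)"
    and r: "r \<in> set_pmf (response (posterior P (adaptive_mechanism M i) A u)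
      (M (Suc i)) (next_query A u))"
    unfolding response_adaptive_mechanism_Suc by auto
  show ?case
    unfolding v posterior_extend_view[OF u r] posterior_family.simps
    using Suc.IH[OF u] next_query_in[OF assms(1) u] r
    by (force simp: resp_prob_eq pmf_positive pmf_posterior)
qed

section \<open>Induction over the number of mechanisms\<close>

lemma LSS_adaptive_mechanism:
  assumes LSS: "\<And>i. i \<in> {1..k} \<Longrightarrow>
      LSS_family (\<epsilon> i) (\<delta> i) (M i) (posterior_family M \<Q> \<D> (i - 1)) \<Q>"
    and analyst: "issues_queries_in A \<Q>" and P: "P \<in> \<D>"
  shows "LSS (\<Sum>i=1..k. \<epsilon> i) (\<Sum>i=1..k. \<delta> i) (adaptive_mechanism M k) P A"
  using LSS
proof (induction k)
  case 0
  have "(\<integral>\<^sup>+v. ennreal (stat_dist (posterior P (adaptive_mechanism M 0) A v) P)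
      \<partial>response P (adaptive_mechanism M 0) A)
    = (\<integral>\<^sup>+v. 0 \<partial>response P (adaptive_mechanism M 0) A)"
    by (intro nn_integral_cong_AE AE_pmfI)
      (simp add: posterior_initial_view del: adaptive_mechanism.simps)
  then show ?case
    by (simp add: LSS_iff_nn_integral del: adaptive_mechanism.simps)
next
  case (Suc k)
  let ?D = "response P (adaptive_mechanism M k) A"
  let ?Q = "\<lambda>v. posterior P (adaptive_mechanism M k) A v"
  let ?E = "\<lambda>v. response (?Q v) (M (Suc k)) (next_query A v)"
  let ?eps = "\<Sum>i=1..k. \<epsilon> i" and ?del = "\<Sum>i=1..k. \<delta> i"
  have IH: "0 \<le> ?del" "(\<integral>\<^sup>+v. ennreal (stat_dist (?Q v) P - ?eps) \<partial>?D) \<le> ennreal ?del"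
    using Suc.IH[OF Suc.prems] by (simp_all add: LSS_iff_nn_integral)
  have step: "0 \<le> \<delta> (Suc k)"
    "(\<integral>\<^sup>+r. ennreal (stat_dist (posterior (?Q v) (M (Suc k)) (next_query A v) r) (?Q v) - \<epsilon> (Suc k))
      \<partial>?E v) \<le> ennreal (\<delta> (Suc k))" if "v \<in> set_pmf ?D" for v
  proof -
    \<comment> \<open>The index \<open>Suc k - 1\<close> in the hypothesis is the family of
      posteriors after \<open>k\<close> responses.\<close>
    have "LSS (\<epsilon> (Suc k)) (\<delta> (Suc k)) (M (Suc k)) (?Q v) (next_query A v)"
      using Suc.prems[of "Suc k"] posterior_in_posterior_family[OF analyst P that]
        next_query_in[OF analyst that]
      by (simp add: LSS_family_def)
    then show "0 \<le> \<delta> (Suc k)"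
      "(\<integral>\<^sup>+r. ennreal (stat_dist (posterior (?Q v) (M (Suc k)) (next_query A v) r) (?Q v) - \<epsilon> (Suc k))
        \<partial>?E v) \<le> ennreal (\<delta> (Suc k))"
      by (simp_all add: LSS_iff_nn_integral)
  qed
  \<comment> \<open>\<open>step\<close> speaks only of reachable views; one exists because the
    support of a pmf is nonempty.\<close>
  have delta: "0 \<le> \<delta> (Suc k)"
    using step(1) set_pmf_not_empty[of ?D] by blast
  have "(\<integral>\<^sup>+w. ennreal (stat_dist (posterior P (adaptive_mechanism M (Suc k)) A w) P
        - (\<Sum>i=1..Suc k. \<epsilon> i)) \<partial>response P (adaptive_mechanism M (Suc k)) A)
    = (\<integral>\<^sup>+v. \<integral>\<^sup>+r. ennreal (stat_dist (posterior P (adaptive_mechanism M (Suc k)) A (extend_view v r)) P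
        - (\<Sum>i=1..Suc k. \<epsilon> i)) \<partial>?E v \<partial>?D)"
    by (simp add: response_adaptive_mechanism_Suc del: adaptive_mechanism.simps)
  also have "\<dots> \<le> (\<integral>\<^sup>+v. \<integral>\<^sup>+r. ennreal (stat_dist (?Q v) P - ?eps)
      + ennreal (stat_dist (posterior (?Q v) (M (Suc k)) (next_query A v) r) (?Q v) - \<epsilon> (Suc k))
      \<partial>?E v \<partial>?D)"
  proof (intro nn_integral_mono_AE AE_pmfI)
    fix v r
    assume v: "v \<in> set_pmf ?D" and r: "r \<in> set_pmf (?E v)"
    let ?a = "stat_dist (?Q v) P - ?eps"
    let ?b = "stat_dist (posterior (?Q v) (M (Suc k)) (next_query A v) r) (?Q v) - \<epsilon> (Suc k)"
    \<comment> \<open>The triangle inequality goes through \<open>?Q v\<close>, the posterior before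
      the last response.\<close>
    have "stat_dist (posterior P (adaptive_mechanism M (Suc k)) A (extend_view v r)) P
        - (\<Sum>i=1..Suc k. \<epsilon> i) \<le> max 0 ?a + max 0 ?b"
      using stat_dist_triangle[of "posterior (?Q v) (M (Suc k)) (next_query A v) r" P "?Q v"]
      by (simp add: posterior_extend_view[OF v r] del: adaptive_mechanism.simps)
    then show "ennreal (stat_dist (posterior P (adaptive_mechanism M (Suc k)) A (extend_view v r)) P
        - (\<Sum>i=1..Suc k. \<epsilon> i)) \<le> ennreal ?a + ennreal ?b"
      by (rule order_trans[OF ennreal_leI]) simp
  qed
  also have "\<dots> = (\<integral>\<^sup>+v. ennreal (stat_dist (?Q v) P - ?eps) + (\<integral>\<^sup>+r. ennreal (stat_dist
      (posterior (?Q v) (M (Suc k)) (next_query A v) r) (?Q v) - \<epsilon> (Suc k)) \<partial>?E v) \<partial>?D)"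
    by (simp add: nn_integral_add measure_pmf.emeasure_space_1)
  \<comment> \<open>The inner bound is uniform over reachable \<open>v\<close>, so integrating over
    views adds only the constant \<open>\<delta> (Suc k)\<close>.\<close>
  also have "\<dots> \<le> (\<integral>\<^sup>+v. ennreal (stat_dist (?Q v) P - ?eps) + ennreal (\<delta> (Suc k)) \<partial>?D)"
    by (intro nn_integral_mono_AE AE_pmfI add_left_mono step)
  also have "\<dots> = (\<integral>\<^sup>+v. ennreal (stat_dist (?Q v) P - ?eps) \<partial>?D) + ennreal (\<delta> (Suc k))"
    by (simp add: nn_integral_add measure_pmf.emeasure_space_1)
  also have "\<dots> \<le> ennreal (\<Sum>i=1..Suc k. \<delta> i)"
    using IH delta by (simp add: add_right_mono)
  finally show ?case
    unfolding LSS_iff_nn_integral using IH(1) delta by simp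
qed

theorem theorem2p9:
  fixes n k :: nat
    and \<D> :: "('x::countable) list pmf set"
    and \<Q> :: "('q::countable) set"
    and M :: "nat \<Rightarrow> ('x, 'q, 'r::countable) mechanism"
    and \<epsilon> \<delta> :: "nat \<Rightarrow> real"
    and A :: "('c, 'q, 'r) analyst"
  assumes datasets: "\<And>P s. P \<in> \<D> \<Longrightarrow> s \<in> set_pmf P \<Longrightarrow> length s = n"
    and eps: "\<And>i. i \<in> {1..k} \<Longrightarrow> 0 \<le> \<epsilon> i \<and> \<epsilon> i \<le> 1"
    and delta: "\<And>i. i \<in> {1..k} \<Longrightarrow> 0 \<le> \<delta> i \<and> \<delta> i \<le> 1"
    and LSS: "\<And>i. i \<in> {1..k} \<Longrightarrow>
      LSS_family (\<epsilon> i) (\<delta> i) (M i) (posterior_family M \<Q> \<D> (i - 1)) \<Q>"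
    and analyst: "issues_queries_in A \<Q>"
  shows "k_LSS (\<Sum>i=1..k. \<epsilon> i) (\<Sum>i=1..k. \<delta> i) k M \<D> A"
  unfolding k_LSS_def using LSS_adaptive_mechanism[OF LSS analyst] by blast

end
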